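(* Let $n$ be a non-negative integer and let $j\in[0,n)$ be a real number. Then $f^j_n(x)\to 0$ as $x\to\infty$, where $f^j_n(x)=\sum_{k=1}^{2^n} s_k\,(x+k)^j$ and $(s_k)_{k\ge 1}$ is the Thue–Morse sequence on the values $1$ and $-1$.
   Context: The Thue–Morse sequence $(s_k)_{k=1}^\infty=(1,-1,-1,1,-1,1,1,-1,\dots)$ on the integers $1$ and $-1$ is determined by $s_1=1$ and $s_{2^m+k}=-s_k$ for all integers $m\ge 0$ and $1\le k\le 2^m$. For a real number $j\ge 0$ and real $x\geq 0$, the functions $f^j_n$ are defined recursively by $f^j_0(x)=(x+1)^j$ and $f^j_n(x)=f^j_{n-1}(x)-f^j_{n-1}(x+2^{n-1})$ for integers $n\ge 1$; equivalently, $f^j_n(x)=\sum_{k=1}^{2^n}s_k(x+k)^j$. Here $x$ is a real variable and $(x+k)^j$ denotes the usual real power of a positive real number. *)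

theory Defs
  imports "HOL-Analysis.Analysis" "HOL-Library.Discrete_Functions"
begin

text \<open>
  The sequence is indexed from 1; the value at index 0 is never used. For \<open>k \<ge> 2\<close> the number
  \<open>m = floor_log (k - 1)\<close> is the unique one with \<open>2 ^ m < k \<le> 2 ^ (m + 1)\<close>, so the second branch is
  the recurrence \<open>s (2 ^ m + k') = - s k'\<close> with \<open>1 \<le> k' \<le> 2 ^ m\<close>, read from left to right.
\<close>

function thue_morse :: "nat \<Rightarrow> int" where
  "thue_morse k = (if k \<le> 1 then 1 else - thue_morse (k - 2 ^ floor_log (k - 1)))"
  by auto
termination
  by (relation "Wellfounded.measure id") auto

declare thue_morse.simps [simp del]

lemma thue_morse_1: "thue_morse 1 = 1"
  by (subst thue_morse.simps) simp

lemma thue_morse_pow2_add: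
  assumes "1 \<le> k" "k \<le> 2 ^ m"
  shows "thue_morse (2 ^ m + k) = - thue_morse k"
proof -
  have "floor_log (2 ^ m + k - 1) = m"
    by (rule floor_log_eqI) (use assms in auto)
  moreover have "\<not> 2 ^ m + k \<le> 1"
    using assms(1) one_le_power [of "2 :: nat" m] by linarith
  ultimately show ?thesis
    by (subst thue_morse.simps) simp
qed

text \<open>
  For \<open>x \<ge> 0\<close> every base \<open>x + real k\<close> below is positive, so \<open>powr\<close> is the usual real power there.
\<close>

definition thue_morse_sum :: "real \<Rightarrow> nat \<Rightarrow> real \<Rightarrow> real" where
  "thue_morse_sum j n x = (\<Sum>k = 1..2 ^ n. real_of_int (thue_morse k) * (x + real k) powr j)"

lemma thue_morse_sum_0: "thue_morse_sum j 0 x = (x + 1) powr j"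
  by (simp add: thue_morse_sum_def thue_morse_1 flip: One_nat_def)

lemma thue_morse_sum_Suc:
  "thue_morse_sum j (Suc n) x = thue_morse_sum j n x - thue_morse_sum j n (x + 2 ^ n)"
proof -
  let ?g = "\<lambda>k. real_of_int (thue_morse k) * (x + real k) powr j"
  have "{1..2 ^ Suc n} = {1..2 ^ n} \<union> {1 + 2 ^ n..2 ^ n + 2 ^ n :: nat}"
    by auto
  then have "(\<Sum>k = 1..2 ^ Suc n. ?g k)
      = (\<Sum>k = 1..2 ^ n. ?g k) + (\<Sum>k = 1 + 2 ^ n..2 ^ n + 2 ^ n. ?g k)"
    by (simp only:) (rule sum.union_disjoint, auto)
  also have "(\<Sum>k = 1 + 2 ^ n..2 ^ n + 2 ^ n. ?g k) = (\<Sum>k = 1..2 ^ n. ?g (k + 2 ^ n))"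
    by (rule sum.shift_bounds_cl_nat_ivl)
  also have "\<dots> = - thue_morse_sum j n (x + 2 ^ n)"
    unfolding thue_morse_sum_def sum_negf [symmetric]
  proof (rule sum.cong [OF refl])
    fix k :: nat
    assume "k \<in> {1..2 ^ n}"
    then have "thue_morse (k + 2 ^ n) = - thue_morse k"
      using thue_morse_pow2_add [of k n] by (simp add: add.commute)
    then show "?g (k + 2 ^ n)
        = - (real_of_int (thue_morse k) * (x + 2 ^ n + real k) powr j)"
      by (simp add: algebra_simps)
  qed
  finally show ?thesis
    by (simp add: thue_morse_sum_def)
qed

end

theory Submission
  imports Defs
begin

text \<open>
  Since differentiation in \<open>x\<close> lowers the exponent of the sum by one and the sum of order \<open>n + 1\<close> is
  a difference of two values of the sum of order \<open>n\<close>, the mean value theorem reduces \<open>(n + 1, j)\<close>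
  to \<open>(n, j - 1)\<close>. Iterating this leads to \<open>n = 0\<close> with a negative exponent, where the
  claim is clear; so the induction runs over all real \<open>j < n\<close>, negative ones included.
\<close>

lemma has_real_derivative_thue_morse_sum:
  assumes "x \<ge> 0"
  shows "((\<lambda>x. thue_morse_sum j n x) has_real_derivative j * thue_morse_sum (j - 1) n x) (at x)"
  unfolding thue_morse_sum_def sum_distrib_left
proof (rule DERIV_sum)
  fix k :: nat
  assume "k \<in> {1..2 ^ n}"
  \<comment> \<open>The indices start at 1, so the base is positive even at \<open>x = 0\<close>,
    where \<open>powr\<close> is still differentiable.\<close>
  then have "x + real k > 0"
    using assms by auto
  then show "((\<lambda>x. real_of_int (thue_morse k) * (x + real k) powr j) has_real_derivative
      j * (real_of_int (thue_morse k) * (x + real k) powr (j - 1))) (at x)"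
    by (auto intro!: derivative_eq_intros)
qed

text \<open>The factor \<open>2 ^ n\<close> is the length of the interval from \<open>x\<close> to
  \<open>x + 2 ^ n\<close>; the sign is negative because the recursion subtracts the value at the
  right end. The bound \<open>z \<ge> x\<close> makes \<open>z\<close> tend to infinity with
  \<open>x\<close>.\<close>

lemma thue_morse_sum_Suc_mean_value:
  assumes "x \<ge> 0"
  obtains z where "z \<ge> x" "thue_morse_sum j (Suc n) x = - (2 ^ n * j) * thue_morse_sum (j - 1) n z"
proof -
  have "\<exists>z>x. z < x + 2 ^ n \<and> thue_morse_sum j n (x + 2 ^ n) - thue_morse_sum j n x
      = (x + 2 ^ n - x) * (j * thue_morse_sum (j - 1) n z)"
    by (rule MVT2) (use assms in \<open>auto intro: has_real_derivative_thue_morse_sum\<close>)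
  then obtain z where "z > x" "thue_morse_sum j n (x + 2 ^ n) - thue_morse_sum j n x
      = (x + 2 ^ n - x) * (j * thue_morse_sum (j - 1) n z)"
    by blast
  then show thesis
    by (intro that [of z]) (auto simp: thue_morse_sum_Suc algebra_simps)
qed

lemma thue_morse_sum_tendsto_0:
  assumes "j < real n"
  shows "((\<lambda>x. thue_morse_sum j n x) \<longlongrightarrow> 0) at_top"
  using assms
proof (induction n arbitrary: j)
  case 0
  then have "((\<lambda>x. (x + 1) powr j) \<longlongrightarrow> 0) at_top"
    by (intro tendsto_neg_powr filterlim_at_top_mono [OF filterlim_ident]) auto
  then show ?case
    by (simp add: thue_morse_sum_0)
next
  case (Suc n)
  have "\<exists>z\<ge>x. thue_morse_sum j (Suc n) x = - (2 ^ n * j) * thue_morse_sum (j - 1) n z"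
    if "x \<ge> 0" for x
    using that by (rule thue_morse_sum_Suc_mean_value) blast
  \<comment> \<open>Choosing the intermediate points as a function of \<open>x\<close> lets the
    limit for \<open>j - 1\<close> be composed with it. For negative \<open>x\<close> its values are
    arbitrary, which does not affect limits at infinity.\<close>
  then obtain \<xi> where \<xi>: "\<xi> x \<ge> x"
      "thue_morse_sum j (Suc n) x = - (2 ^ n * j) * thue_morse_sum (j - 1) n (\<xi> x)"
    if "x \<ge> 0" for x
    by metis
  have "filterlim \<xi> at_top at_top"
    by (rule filterlim_at_top_mono [OF filterlim_ident])
      (use \<xi>(1) in \<open>auto intro: eventually_mono [OF eventually_ge_at_top [of 0]]\<close>)
  moreover have "((\<lambda>x. thue_morse_sum (j - 1) n x) \<longlongrightarrow> 0) at_top"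
    using Suc.prems by (intro Suc.IH) simp
  ultimately have "((\<lambda>x. thue_morse_sum (j - 1) n (\<xi> x)) \<longlongrightarrow> 0) at_top"
    by (rule filterlim_compose [rotated])
  then have "((\<lambda>x. - (2 ^ n * j) * thue_morse_sum (j - 1) n (\<xi> x)) \<longlongrightarrow> 0) at_top"
    by (rule tendsto_mult_right_zero)
  then show ?case
    by (rule Lim_transform_eventually)
      (use \<xi>(2) in \<open>auto intro: eventually_mono [OF eventually_ge_at_top [of 0]]\<close>)
qed

theorem theorem3:
  fixes n :: nat and j :: real
  assumes "j \<in> {0..<real n}"
  shows "((\<lambda>x. thue_morse_sum j n x) \<longlongrightarrow> 0) at_top"
  using assms by (intro thue_morse_sum_tendsto_0) simp

end
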